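(* Let $F_{[X]}\colon\mathbb{R}^2\to[0,1]$ be the containment distribution function of a random interval $[X]$. If $F_{[X]}$ is twice differentiable, then the density function of $[X]$ is $$f_{[X]}(\underline{x},\overline{x})=-\frac{\partial^2}{\partial\underline{x}\,\partial\overline{x}}F_{[X]}(\underline{x},\overline{x}).$$
   Context: $\mathbb{I}=\{[x,y]\colon -\infty<x\le y<+\infty\}$ is the set of closed bounded intervals of $\mathbb{R}$ (including degenerate ones); for $[x]\in\mathbb{I}$ write $[x]=[\underline{x},\overline{x}]$. $\mathbb{I}$ carries the Hausdorff metric $d_H([a],[b])=\max\{|\underline{a}-\underline{b}|,|\overline{a}-\overline{b}|\}$ and its Borel $\sigma$-algebra $\mathscr{B}_{\mathbb{I}}$; the map $h([x])=(\underline{x},\overline{x})$ identifies $\mathbb{I}$ isometrically with $\{(u,v)\in\mathbb{R}^2\colon u\le v\}$ under the sup metric. A random interval $[X]=[\underline{X},\overline{X}]$ is a random element of $\mathbb{I}$. The uniform measure on $\mathbb{I}$ is $\mu_{\mathbb{I}}(E)=\mu(h(E))$, with $\mu$ Lebesgue measure on $\mathbb{R}^2$. The density function of $[X]$ is the Radon–Nikodym derivative of the law of $[X]$ with respect to $\mu_{\mathbb{I}}$ (regarded as a function of $(\underline{x},\overline{x})$; equivalently, the joint density of $(\underline{X},\overline{X})$). The containment distribution function of $[X]$ is $F_{[X]}\colon\mathbb{R}^2\to[0,1]$, $F_{[X]}(\underline{x},\overline{x})=P([X]\subseteq[\underline{x},\overline{x}])$ for $\underline{x}\le\overline{x}$,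 and $F_{[X]}(\underline{x},\overline{x})=0$ for $\underline{x}>\overline{x}$. Twice differentiability is meant for $F_{[X]}$ as a function on all of $\mathbb{R}^2$. The claim includes that the law of $[X]$ is absolutely continuous with respect to $\mu_{\mathbb{I}}$. *)

theory Defs
  imports "HOL-Probability.Probability" "HOL-Library.Interval"
begin

section \<open>The space of compact intervals\<close>

text \<open>
  Intervals are elements of the library type \<^typ>\<open>real interval\<close>, with end points
  \<^const>\<open>lower\<close> and \<^const>\<open>upper\<close> and point set \<^const>\<open>set_of\<close>.

  The topology that the library puts on this type is not used. Its open sets are
  defined through \<open>Interval ` (A \<times> B)\<close>, which for overlapping \<open>A\<close> and \<open>B\<close> contains unspecified
  values \<open>Interval (a, b)\<close> with \<open>b < a\<close>; around degenerate intervals it therefore need not be the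
  topology of the Hausdorff metric.
\<close>

definition hausdorff_dist :: "real interval \<Rightarrow> real interval \<Rightarrow> real" where
  "hausdorff_dist a b = max \<bar>lower a - lower b\<bar> \<bar>upper a - upper b\<bar>"

global_interpretation hausdorff: Metric_space UNIV hausdorff_dist
  by unfold_locales (auto simp: hausdorff_dist_def interval_eq_iff)

definition interval_borel :: "real interval measure" where
  "interval_borel = sigma UNIV {U. openin hausdorff.mtopology U}"

definition endpoints :: "real interval \<Rightarrow> real \<times> real" where
  "endpoints x = (lower x, upper x)"

definition uniform_interval_measure :: "real interval measure" where
  "uniform_interval_measure =
     measure_of UNIV (sets interval_borel) (\<lambda>E. emeasure lborel (endpoints ` E))"

lemma space_interval_borel [simp]: "space interval_borel = UNIV"
  by (simp add: interval_borel_def space_measure_of_conv)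

lemma inj_endpoints: "inj endpoints"
  by (auto simp: inj_def endpoints_def interval_eq_iff)

lemma range_endpoints: "range endpoints = {p. fst p \<le> snd p}"
proof -
  have "p \<in> range endpoints" if "fst p \<le> snd p" for p
  proof -
    have "endpoints (Interval p) = p"
      using that
      by (cases p) (simp add: endpoints_def lower.rep_eq upper.rep_eq Interval_inverse)
    then show ?thesis by (metis rangeI)
  qed
  then show ?thesis by (auto simp: endpoints_def)
qed

lemma hausdorff_open_iff:
  "openin hausdorff.mtopology U \<longleftrightarrow> (\<exists>V. open V \<and> U = endpoints -` V)"
proof
  assume U: "openin hausdorff.mtopology U"
  define V where "V = \<Union>{S. open S \<and> endpoints -` S \<subseteq> U}"
  have "open V" unfolding V_def by blast
  moreover have "U = endpoints -` V"
  proof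
    show "U \<subseteq> endpoints -` V"
    proof
      fix x assume "x \<in> U"
      then obtain r where r: "r > 0" "hausdorff.mball x r \<subseteq> U"
        using U unfolding hausdorff.openin_mtopology by blast
      let ?S = "{lower x - r <..< lower x + r} \<times> {upper x - r <..< upper x + r}"
      have "open ?S" by (intro open_Times) auto
      moreover have "endpoints -` ?S \<subseteq> hausdorff.mball x r"
        by (auto simp: endpoints_def hausdorff.mball_def hausdorff_dist_def)
      moreover have "endpoints x \<in> ?S" using r by (simp add: endpoints_def)
      ultimately show "x \<in> endpoints -` V" using r unfolding V_def by blast
    qed
    show "endpoints -` V \<subseteq> U" unfolding V_def by blast
  qed
  ultimately show "\<exists>V. open V \<and> U = endpoints -` V" by blast
next
  assume "\<exists>V. open V \<and> U = endpoints -` V"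
  then obtain V where V: "open V" "U = endpoints -` V" by blast
  have "\<exists>r>0. hausdorff.mball x r \<subseteq> U" if x: "x \<in> U" for x
  proof -
    obtain e where e: "e > 0" "\<And>y. dist y (endpoints x) < e \<Longrightarrow> y \<in> V"
      using V x unfolding open_dist by (metis vimageE)
    have "dist (endpoints y) (endpoints x) < e" if "y \<in> hausdorff.mball x (e / 2)" for y
    proof -
      have "dist (endpoints y) (endpoints x)
          \<le> \<bar>lower y - lower x\<bar> + \<bar>upper y - upper x\<bar>"
        unfolding endpoints_def dist_Pair_Pair dist_real_def
        by (rule order_trans[OF sqrt_sum_squares_le_sum_abs]) simp
      also have "\<dots> < e"
        using that unfolding hausdorff.in_mball hausdorff_dist_def by linarith
      finally show ?thesis .
    qed
    then have "hausdorff.mball x (e / 2) \<subseteq> U" using e V by blast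
    then show ?thesis using e by (intro exI[of _ "e / 2"]) auto
  qed
  then show "openin hausdorff.mtopology U" by (simp add: hausdorff.openin_mtopology)
qed

lemma interval_borel_eq_vimage: "interval_borel = vimage_algebra UNIV endpoints borel"
proof -
  have "vimage_algebra UNIV endpoints (sigma UNIV {V. open V}) =
      sigma UNIV {endpoints -` V \<inter> UNIV |V. V \<in> {V. open V}}"
    by (rule vimage_algebra_sigma) auto
  also have "{endpoints -` V \<inter> UNIV |V. V \<in> {V. open V}} = {U. openin hausdorff.mtopology U}"
    by (auto simp: hausdorff_open_iff)
  finally show ?thesis by (simp add: interval_borel_def borel_def)
qed

lemma endpoints_measurable: "endpoints \<in> borel_measurable interval_borel"
  unfolding interval_borel_eq_vimage by (rule measurable_vimage_algebra1) simp

lemma sets_endpoints_image: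
  assumes "E \<in> sets interval_borel"
  shows "endpoints ` E \<in> sets borel"
proof -
  obtain A where A: "A \<in> sets borel" "E = endpoints -` A"
    using assms by (auto simp: interval_borel_eq_vimage sets_vimage_algebra2)
  have "endpoints ` E = A \<inter> {p. fst p \<le> snd p}"
    using A range_endpoints by auto
  moreover have "closed {p::real \<times> real. fst p \<le> snd p}"
    by (intro closed_Collect_le continuous_intros)
  ultimately show ?thesis using A by auto
qed

lemma sets_uniform_interval_measure [simp]:
  "sets uniform_interval_measure = sets interval_borel"
  unfolding uniform_interval_measure_def
  by (metis sets.sets_measure_of_eq space_interval_borel)

lemma space_uniform_interval_measure [simp]: "space uniform_interval_measure = UNIV"
  by (simp add: uniform_interval_measure_def space_measure_of_conv)

lemma emeasure_uniform_interval_measure: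
  assumes "E \<in> sets interval_borel"
  shows "emeasure uniform_interval_measure E = emeasure lborel (endpoints ` E)"
proof (rule emeasure_measure_of[OF uniform_interval_measure_def])
  show "sets interval_borel \<subseteq> Pow UNIV" by simp
  show "E \<in> sets uniform_interval_measure" using assms by simp
  show "positive (sets uniform_interval_measure) (\<lambda>E. emeasure lborel (endpoints ` E))"
    by (simp add: positive_def)
  show "countably_additive (sets uniform_interval_measure) (\<lambda>E. emeasure lborel (endpoints ` E))"
  proof (rule countably_additiveI)
    fix A :: "nat \<Rightarrow> real interval set"
    assume A: "range A \<subseteq> sets uniform_interval_measure" "disjoint_family A"
    have "(\<Sum>i. emeasure lborel (endpoints ` A i)) = emeasure lborel (\<Union>i. endpoints ` A i)"
    proof (rule suminf_emeasure)
      show "range (\<lambda>i. endpoints ` A i) \<subseteq> sets lborel"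
        using A by (auto intro!: sets_endpoints_image)
      show "disjoint_family (\<lambda>i. endpoints ` A i)"
        using A(2) inj_endpoints unfolding disjoint_family_on_def
        by (metis image_Int image_empty)
    qed
    then show "(\<Sum>i. emeasure lborel (endpoints ` A i)) =
        emeasure lborel (endpoints ` (\<Union>i. A i))"
      by (simp add: image_UN)
  qed
qed

section \<open>Random intervals\<close>

abbreviation random_interval :: "'w measure \<Rightarrow> ('w \<Rightarrow> real interval) \<Rightarrow> bool" where
  "random_interval M X \<equiv> X \<in> M \<rightarrow>\<^sub>M interval_borel"

abbreviation interval_law :: "'w measure \<Rightarrow> ('w \<Rightarrow> real interval) \<Rightarrow> real interval measure" where
  "interval_law M X \<equiv> distr M interval_borel X"

definition containment_cdf :: "'w measure \<Rightarrow> ('w \<Rightarrow> real interval) \<Rightarrow> real \<times> real \<Rightarrow> real" where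
  "containment_cdf M X =
     (\<lambda>(u, v). if u \<le> v then measure M {\<omega> \<in> space M. set_of (X \<omega>) \<subseteq> {u..v}} else 0)"

text \<open>
  A density function of \<open>X\<close> is a real-valued function of the two end points that, along
  \<^const>\<open>endpoints\<close>, is a version of the Radon-Nikodym derivative of the law of \<open>X\<close>.
  The conjunct \<open>0 \<le> f (endpoints x)\<close> is needed since \<^const>\<open>ennreal\<close> maps negative numbers to 0,
  and absolute continuity since \<^const>\<open>RN_deriv\<close> is meaningful only in its presence.
\<close>

definition is_interval_density ::
  "'w measure \<Rightarrow> ('w \<Rightarrow> real interval) \<Rightarrow> (real \<times> real \<Rightarrow> real) \<Rightarrow> bool" where
  "is_interval_density M X f \<longleftrightarrow>
     absolutely_continuous uniform_interval_measure (interval_law M X) \<and>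
     (\<lambda>x. f (endpoints x)) \<in> borel_measurable uniform_interval_measure \<and>
     (AE x in uniform_interval_measure.
        0 \<le> f (endpoints x) \<and>
        RN_deriv uniform_interval_measure (interval_law M X) x = ennreal (f (endpoints x)))"

section \<open>Differentiability\<close>

text \<open>Twice Frechet differentiable at every point; the second derivative need not be continuous.\<close>

definition twice_differentiable ::
  "('a::real_normed_vector \<Rightarrow> 'b::real_normed_vector) \<Rightarrow> bool" where
  "twice_differentiable F \<longleftrightarrow>
     (\<exists>F' :: 'a \<Rightarrow> 'a \<Rightarrow>\<^sub>L 'b.
        (\<forall>p. (F has_derivative blinfun_apply (F' p)) (at p)) \<and>
        (\<forall>p. F' differentiable (at p)))"

definition mixed_partial :: "(real \<times> real \<Rightarrow> real) \<Rightarrow> real \<times> real \<Rightarrow> real" where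
  "mixed_partial F = (\<lambda>(u, v). deriv (\<lambda>s. deriv (\<lambda>t. F (s, t)) v) u)"

end

theory Submission
  imports Defs
begin

text \<open>
  Let \<open>\<nu>\<close> be the law of the end points in the plane. Up to sign, \<open>\<nu>\<close> of a half-open square is the second
  difference of the containment distribution function \<open>F\<close>. By the mean value theorem and
  differentiability of \<open>\<partial>F/\<partial>v\<close> at \<open>p\<close>, the ratio of \<open>\<nu>\<close> to the area of the dyadic square containing
  \<open>p\<close> tends to minus the mixed partial derivative at every point \<open>p\<close>; no continuity of second
  derivatives is needed. Dyadic squares are nested or disjoint, so bounds on these ratios
  carry over to Borel sets by outer regularity, without a Vitali covering. As the limit is finite
  everywhere, \<open>\<nu>\<close> has no singular part, and its Radon-Nikodym derivative agrees almost everywhere with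
  the limit.
\<close>

section \<open>Second differences\<close>

text \<open>The mean value theorem in the second variable turns the second difference into
  \<open>h\<close> times an increment of \<open>D\<close> in the first variable, and
  differentiability of \<open>D\<close> at \<open>p\<close> alone controls that increment. The
  square only has to contain \<open>p\<close>, without being centred there, because dyadic cells are
  not centred at their points.\<close>

lemma second_difference_approx:
  fixes F D D' :: "real \<times> real \<Rightarrow> real"
  assumes F: "\<And>s t. ((\<lambda>t. F (s, t)) has_real_derivative D (s, t)) (at t)"
    and D: "(D has_derivative D') (at p)"
    and "0 < e"
  shows "\<exists>\<delta>>0. \<forall>h s t. 0 < h \<longrightarrow> h < \<delta> \<longrightarrow> fst p \<in> {s..s + h} \<longrightarrow> snd p \<in> {t..t + h} \<longrightarrow>
    \<bar>(F (s + h, t + h) - F (s, t + h) - F (s + h, t) + F (s, t)) / h\<^sup>2 - D' (1, 0)\<bar> \<le> e"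
proof -
  interpret D': bounded_linear D' using D by (rule has_derivative_bounded_linear)
  \<comment> \<open>Both points used below lie within \<open>2 * h\<close> of \<open>p\<close>, so
    \<open>h < d / 2\<close> brings them into range, and \<open>e / 4\<close> makes each error at
    most \<open>e / 2 * h\<close>, in total \<open>e * h\<close>.\<close>
  obtain d where d: "d > 0"
    "\<And>q. norm (q - p) < d \<Longrightarrow> \<bar>D q - D p - D' (q - p)\<bar> \<le> e / 4 * norm (q - p)"
    using D \<open>0 < e\<close> unfolding has_derivative_at_alt by (metis zero_less_divide_iff real_norm_def zero_less_numeral)
  have "\<bar>(F (s + h, t + h) - F (s, t + h) - F (s + h, t) + F (s, t)) / h\<^sup>2 - D' (1, 0)\<bar> \<le> e"
    if h: "0 < h" "h < d / 2" and s: "fst p \<in> {s..s + h}" and t: "snd p \<in> {t..t + h}" for h s t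
  proof -
    \<comment> \<open>The theorem is applied to the difference of the two vertical sections, so that
      both values of \<open>D\<close> are taken at the same height \<open>z\<close>.\<close>
    have "\<exists>z. t < z \<and> z < t + h \<and>
      (F (s + h, t + h) - F (s, t + h)) - (F (s + h, t) - F (s, t)) = (t + h - t) * (D (s + h, z) - D (s, z))"
      using h by (intro MVT2 DERIV_diff F) auto
    then obtain z where z: "t < z" "z < t + h"
      and eq: "(F (s + h, t + h) - F (s, t + h)) - (F (s + h, t) - F (s, t)) = h * (D (s + h, z) - D (s, z))"
      by auto
    have near: "\<bar>D (x, z) - D p - D' ((x, z) - p)\<bar> \<le> e / 2 * h" if "x \<in> {s, s + h}" for x
    proof -
      have "norm ((x, z) - p) \<le> \<bar>x - fst p\<bar> + \<bar>z - snd p\<bar>"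
        by (cases p) (auto simp: norm_Pair intro: sqrt_sum_squares_le_sum_abs)
      also have "\<dots> \<le> 2 * h" using that s t z by auto
      finally have n: "norm ((x, z) - p) \<le> 2 * h" .
      have "\<bar>D (x, z) - D p - D' ((x, z) - p)\<bar> \<le> e / 4 * norm ((x, z) - p)"
        using n h by (intro d) auto
      also have "\<dots> \<le> e / 4 * (2 * h)" using n \<open>0 < e\<close> by (intro mult_left_mono) auto
      finally show ?thesis by simp
    qed
    \<comment> \<open>Since the heights agree, the linear parts differ by exactly
      \<open>D' (h, 0)\<close>; the unknown \<open>z\<close> drops out.\<close>
    have "D' ((s + h, z) - p) - D' ((s, z) - p) = D' (h *\<^sub>R (1, 0))"
      by (simp flip: D'.diff)
    also have "\<dots> = h * D' (1, 0)" by (simp only: D'.scaleR real_scaleR_def)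
    finally have "D (s + h, z) - D (s, z) - h * D' (1, 0) =
        (D (s + h, z) - D p - D' ((s + h, z) - p)) - (D (s, z) - D p - D' ((s, z) - p))"
      by (simp only: algebra_simps)
    then have "\<bar>D (s + h, z) - D (s, z) - h * D' (1, 0)\<bar> \<le> e / 2 * h + e / 2 * h"
      by (simp only:) (intro order_trans[OF abs_triangle_ineq4] add_mono near; simp)
    moreover have "F (s + h, t + h) - F (s, t + h) - F (s + h, t) + F (s, t) = h * (D (s + h, z) - D (s, z))"
      using eq by linarith
    then have "(F (s + h, t + h) - F (s, t + h) - F (s + h, t) + F (s, t)) / h\<^sup>2 - D' (1, 0)
      = (D (s + h, z) - D (s, z) - h * D' (1, 0)) / h"
      using h by (simp add: diff_divide_distrib power2_eq_square)
    ultimately show ?thesis using h by (simp add: abs_divide divide_le_eq)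
  qed
  then show ?thesis using \<open>d > 0\<close> by (intro exI[of _ "d / 2"]) auto
qed

section \<open>Differentiation of measures along dyadic cells\<close>

text \<open>
  The second coordinate is negated so that the cells are half-open squares
  \<open>[s, s + h) \<times> (t, t + h]\<close>, whose probabilities are second differences of a
  containment distribution function.
\<close>

definition cell_index :: "nat \<Rightarrow> real \<times> real \<Rightarrow> int \<times> int" where
  "cell_index n p = (\<lfloor>2 ^ n * fst p\<rfloor>, \<lfloor>2 ^ n * (- snd p)\<rfloor>)"

text \<open>As fibres of \<open>cell_index n\<close>, the cells of one level partition the plane,
  and cells of that level sharing a point are equal by pure equational reasoning. The rectangle form
  is recovered in \<open>cell_eq\<close>.\<close>

definition cell :: "nat \<Rightarrow> real \<times> real \<Rightarrow> (real \<times> real) set" where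
  "cell n p = {q. cell_index n q = cell_index n p}"

lemma self_in_cell: "p \<in> cell n p"
  by (simp add: cell_def)

lemma cell_cong: "q \<in> cell n p \<Longrightarrow> cell n q = cell n p"
  by (simp add: cell_def)

lemma cell_eq:
  "cell n p = {real_of_int \<lfloor>2 ^ n * fst p\<rfloor> / 2 ^ n..<real_of_int \<lfloor>2 ^ n * fst p\<rfloor> / 2 ^ n + 1 / 2 ^ n} \<times>
    {- real_of_int \<lfloor>2 ^ n * (- snd p)\<rfloor> / 2 ^ n - 1 / 2 ^ n<..- real_of_int \<lfloor>2 ^ n * (- snd p)\<rfloor> / 2 ^ n}"
  unfolding cell_def cell_index_def
  by (auto simp: floor_eq_iff field_simps)

lemma measurable_cell_index [measurable]:
  "cell_index n \<in> borel \<rightarrow>\<^sub>M count_space UNIV"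
proof -
  have "(\<lambda>p::real \<times> real. \<lfloor>2 ^ n * fst p\<rfloor>) \<in> borel \<rightarrow>\<^sub>M count_space UNIV"
    "(\<lambda>p::real \<times> real. \<lfloor>2 ^ n * (- snd p)\<rfloor>) \<in> borel \<rightarrow>\<^sub>M count_space UNIV"
    by (measurable; simp add: borel_prod[symmetric])+
  then have "{p \<in> space (borel :: (real \<times> real) measure). \<lfloor>2 ^ n * fst p\<rfloor> = i \<and> \<lfloor>2 ^ n * (- snd p)\<rfloor> = j} \<in> sets borel"
    for i j by measurable
  moreover have "cell_index n -` {(i, j)} = {p \<in> space borel. \<lfloor>2 ^ n * fst p\<rfloor> = i \<and> \<lfloor>2 ^ n * (- snd p)\<rfloor> = j}" for i j
    by (auto simp: cell_index_def)
  ultimately have "cell_index n -` {i} \<in> sets borel" for i by (cases i) simp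
  then show ?thesis
    by (subst measurable_count_space_eq2_countable) auto
qed

lemma cell_borel [measurable]: "cell n p \<in> sets borel"
  unfolding cell_def by measurable

lemma emeasure_lborel_cell: "emeasure lborel (cell n p) = ennreal (1 / 4 ^ n)"
proof -
  have "emeasure lborel (cell n p) = ennreal (1 / 2 ^ n) * ennreal (1 / 2 ^ n)"
    unfolding cell_eq lborel_prod[symmetric]
    by (subst lborel.emeasure_pair_measure_Times) simp_all
  also have "\<dots> = ennreal (1 / 2 ^ n * (1 / 2 ^ n))" by (rule ennreal_mult'[symmetric]) simp
  also have "(1 / 2 ^ n * (1 / 2 ^ n) :: real) = 1 / 4 ^ n"
    using power_mult_distrib[of "2::real" 2 n] by simp
  finally show ?thesis .
qed

lemma cell_Suc_subset: "cell (Suc n) p \<subseteq> cell n p"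
proof -
  \<comment> \<open>An index at level \<open>n + 1\<close> determines the index at level
    \<open>n\<close> by integer division by 2, so refining never crosses a coarser boundary.\<close>
  have "\<lfloor>2 ^ n * x\<rfloor> = \<lfloor>2 ^ Suc n * x\<rfloor> div 2" for x :: real
    using floor_divide_real_eq_div[of 2 "2 ^ Suc n * x"] by simp
  from this[of "fst _"] this[of "- snd _"] show ?thesis
    unfolding cell_def cell_index_def by auto
qed

lemma cell_antimono: "m \<le> n \<Longrightarrow> cell n p \<subseteq> cell m p"
  using lift_Suc_antimono_le[of "\<lambda>n. cell n p"] cell_Suc_subset by blast

lemma countable_range_cell: "countable (range (cell n))"
proof -
  have "cell n = (\<lambda>i. cell_index n -` {i}) \<circ> cell_index n"
    by (auto simp: cell_def fun_eq_iff)
  then have "range (cell n) = (\<lambda>i. cell_index n -` {i}) ` range (cell_index n)"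
    by (simp only: image_comp)
  then show ?thesis by (simp only:) (intro countable_image countableI_type)
qed

lemma cell_eventually_subset:
  assumes "open U" "p \<in> U"
  shows "\<forall>\<^sub>F n in sequentially. cell n p \<subseteq> U"
proof -
  obtain e where e: "e > 0" "\<And>q. dist q p < e \<Longrightarrow> q \<in> U"
    using assms unfolding open_dist by metis
  have "(\<lambda>n. 2 * (1 / 2) ^ n :: real) \<longlonglongrightarrow> 0" by real_asymp
  then have "\<forall>\<^sub>F n in sequentially. 2 * (1 / 2) ^ n < e"
    using e(1) by (rule order_tendstoD(2))
  then show ?thesis
  proof eventually_elim
    case (elim n)
    show ?case
    proof
      fix q assume q: "q \<in> cell n p"
      have "dist q p \<le> \<bar>fst q - fst p\<bar> + \<bar>snd q - snd p\<bar>"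
        unfolding dist_norm
        by (cases p; cases q) (auto simp: norm_Pair intro: sqrt_sum_squares_le_sum_abs)
      also have "\<bar>fst q - fst p\<bar> \<le> (1 / 2) ^ n"
        using q self_in_cell[of p n] unfolding cell_eq mem_Times_iff power_one_over atLeastLessThan_iff by linarith
      also have "\<bar>snd q - snd p\<bar> \<le> (1 / 2) ^ n"
        using q self_in_cell[of p n] unfolding cell_eq mem_Times_iff power_one_over greaterThanAtMost_iff by linarith
      finally show "q \<in> U" using elim by (intro e) auto
    qed
  qed
qed

section \<open>Comparing measures through coverings by dyadic cells\<close>

text \<open>Maximal cells inside a tight open superset of \<open>E\<close> that satisfy the
  inequality are pairwise disjoint and countable in number, so the inequality can be summed over
  them. It is used twice, with the law and Lebesgue measure exchanging the roles of \<mu> and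
  \<nu>.\<close>

lemma emeasure_le_if_cells_le:
  fixes \<mu> \<nu> :: "(real \<times> real) measure" and c :: real
  assumes [simp, measurable_cong]: "sets \<mu> = sets borel" "sets \<nu> = sets borel"
    and outer: "\<And>e::real. 0 < e \<Longrightarrow> \<exists>U. open U \<and> E \<subseteq> U \<and> emeasure \<mu> U \<le> emeasure \<mu> E + ennreal e"
    and "0 < c"
    and le: "\<And>p. p \<in> E \<Longrightarrow> \<forall>\<^sub>F n in sequentially. emeasure \<nu> (cell n p) \<le> ennreal c * emeasure \<mu> (cell n p)"
  shows "emeasure \<nu> E \<le> ennreal c * emeasure \<mu> E"
proof (rule ennreal_le_epsilon)
  fix e :: real assume "0 < e"
  \<comment> \<open>The slack \<open>e / c\<close> becomes \<open>e\<close> after multiplication by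
    \<open>c\<close>.\<close>
  then obtain U where U: "open U" "E \<subseteq> U" "emeasure \<mu> U \<le> emeasure \<mu> E + ennreal (e / c)"
    using outer[of "e / c"] \<open>0 < c\<close> by auto
  define good where
    "good Q \<longleftrightarrow> Q \<subseteq> U \<and> emeasure \<nu> Q \<le> ennreal c * emeasure \<mu> Q" for Q
  \<comment> \<open>The least index selects the largest good cell around \<open>p\<close>; this is
    what rules out proper nesting among the chosen cells.\<close>
  define m where "m p = (LEAST n. good (cell n p))" for p
  define C where "C = (\<lambda>p. cell (m p) p) ` E"
  have m: "good (cell (m p) p)" if "p \<in> E" for p
  proof -
    have "\<forall>\<^sub>F n in sequentially. good (cell n p)"
      using le[OF that] cell_eventually_subset[of U p] U that
      unfolding good_def by (intro eventually_conj) auto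
    then show ?thesis unfolding m_def by (metis LeastI_ex eventually_sequentially order_refl)
  qed
  have C_good: "good Q" if "Q \<in> C" for Q
    using that m unfolding C_def by auto
  \<comment> \<open>A common point makes the cell of \<open>q\<close> at level \<open>m p\<close>
    equal to the good cell of \<open>p\<close>, so minimality of \<open>m q\<close> forces
    \<open>m q = m p\<close>.\<close>
  have nested: "cell (m p) p = cell (m q) q"
    if "p \<in> E" "q \<in> E" "x \<in> cell (m p) p" "x \<in> cell (m q) q" "m p \<le> m q" for p q x
  proof -
    have "cell (m p) q = cell (m p) p"
      using that cell_antimono[OF that(5), of q] cell_cong by blast
    then have "m q \<le> m p" using m[OF that(1)] unfolding m_def[of q] by (intro Least_le) simp
    then show ?thesis using that \<open>cell (m p) q = cell (m p) p\<close> by simp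
  qed
  have disj: "disjoint_family_on (\<lambda>Q. Q) C"
    unfolding disjoint_family_on_def
  proof (intro ballI impI)
    fix Q R assume "Q \<in> C" "R \<in> C" "Q \<noteq> R"
    then obtain p q where "p \<in> E" "q \<in> E" "Q = cell (m p) p" "R = cell (m q) q"
      unfolding C_def by blast
    with \<open>Q \<noteq> R\<close> show "Q \<inter> R = {}"
      using nested[of p q] nested[of q p] linear[of "m p" "m q"] by blast
  qed
  have "C \<subseteq> (\<Union>n. range (cell n))" unfolding C_def by blast
  then have count: "countable C"
    by (rule countable_subset) (intro countable_UN countableI_type countable_range_cell)
  have sets_C: "Q \<in> sets borel" if "Q \<in> C" for Q
    using that unfolding C_def by auto
  have borel_C: "\<Union> C \<in> sets borel"
    using count sets_C by (intro sets.countable_Union) auto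
  have "E \<subseteq> \<Union> C" unfolding C_def using self_in_cell by auto
  then have "emeasure \<nu> E \<le> emeasure \<nu> (\<Union> C)"
    using borel_C by (intro emeasure_mono) auto
  \<comment> \<open>The sum runs over the set of cells, not over the points of \<open>E\<close>, so
    a cell chosen by many points counts once.\<close>
  also have "\<dots> = (\<integral>\<^sup>+Q. emeasure \<nu> Q \<partial>count_space C)"
    using emeasure_UN_countable[of C "\<lambda>Q. Q" \<nu>] sets_C count disj by simp
  also have "\<dots> \<le> (\<integral>\<^sup>+Q. ennreal c * emeasure \<mu> Q \<partial>count_space C)"
    using C_good unfolding good_def by (intro nn_integral_mono) simp
  also have "\<dots> = ennreal c * (\<integral>\<^sup>+Q. emeasure \<mu> Q \<partial>count_space C)"
    by (intro nn_integral_cmult) simp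
  also have "(\<integral>\<^sup>+Q. emeasure \<mu> Q \<partial>count_space C) = emeasure \<mu> (\<Union> C)"
    using emeasure_UN_countable[of C "\<lambda>Q. Q" \<mu>] sets_C count disj by simp
  also have "\<dots> \<le> emeasure \<mu> U"
    using C_good U unfolding good_def by (intro emeasure_mono) auto
  also note U(3)
  also have "ennreal c * (emeasure \<mu> E + ennreal (e / c)) = ennreal c * emeasure \<mu> E + ennreal e"
    using \<open>0 < c\<close> \<open>0 < e\<close> by (simp add: distrib_left ennreal_mult'[symmetric])
  finally show "emeasure \<nu> E \<le> ennreal c * emeasure \<mu> E + ennreal e"
    by (simp add: mult_left_mono)
qed

lemma lborel_outer_open:
  fixes E :: "'a::euclidean_space set"
  assumes "E \<in> sets borel" "0 < (e::real)"
  shows "\<exists>U. open U \<and> E \<subseteq> U \<and> emeasure lborel U \<le> emeasure lborel E + ennreal e"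
proof -
  obtain U where U: "open U" "E \<subseteq> U" "emeasure lborel (U - E) < e"
    using outer_regular_lborel assms by metis
  have "emeasure lborel U = emeasure lborel (E \<union> (U - E))" using U by (simp add: Un_absorb1)
  also have "\<dots> \<le> emeasure lborel E + emeasure lborel (U - E)"
    using assms U by (intro emeasure_subadditive) auto
  also have "\<dots> \<le> emeasure lborel E + ennreal e" using U by (intro add_left_mono) simp
  finally show ?thesis using U by blast
qed

lemma finite_measure_outer_open:
  fixes \<nu> :: "'a::{second_countable_topology, complete_space} measure"
  assumes "finite_measure \<nu>" "sets \<nu> = sets borel" "E \<in> sets borel" "0 < (e::real)"
  shows "\<exists>U. open U \<and> E \<subseteq> U \<and> emeasure \<nu> U \<le> emeasure \<nu> E + ennreal e"
proof -
  interpret finite_measure \<nu> by fact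
  have "emeasure \<nu> E = (INF U \<in> {U. E \<subseteq> U \<and> open U}. emeasure \<nu> U)"
    using assms emeasure_finite[of "space \<nu>"] by (intro outer_regular) auto
  \<comment> \<open>Strictness relies on \<nu> being finite; it lets the infimum be undercut by an
    actual open set.\<close>
  moreover have "emeasure \<nu> E < emeasure \<nu> E + ennreal e"
    using assms(4) by (simp add: emeasure_eq_measure ennreal_less_iff flip: ennreal_plus)
  ultimately obtain U where "E \<subseteq> U" "open U" "emeasure \<nu> U < emeasure \<nu> E + ennreal e"
    by (auto simp: INF_less_iff)
  then show ?thesis by (auto intro: less_imp_le)
qed

section \<open>Measures with a finite dyadic derivative at every point\<close>

text \<open>The factor \<open>4 ^ n\<close> is the reciprocal of the cell area, so \<open>f\<close>
  is the derivative of \<nu> with respect to Lebesgue measure along cells. The limit is real-valued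
  and exists at every point, not just almost everywhere.\<close>

locale cell_differentiable = finite_measure \<nu> for \<nu> :: "(real \<times> real) measure" +
  fixes f :: "real \<times> real \<Rightarrow> real"
  assumes sets_eq [simp, measurable_cong]: "sets \<nu> = sets borel"
    and lim: "\<And>p. (\<lambda>n. measure \<nu> (cell n p) * 4 ^ n) \<longlonglongrightarrow> f p"
begin

lemma borel_measurable_limit [measurable]: "f \<in> borel_measurable borel"
proof (rule borel_measurable_LIMSEQ_real[OF lim])
  fix n
  \<comment> \<open>The ratio depends on \<open>p\<close> only through its cell index, which takes
    values in a countable discrete space.\<close>
  have "(\<lambda>p. (\<lambda>i. measure \<nu> (cell_index n -` {i}) * 4 ^ n) (cell_index n p)) \<in> borel_measurable borel"
    by (rule measurable_compose[OF measurable_cell_index]) simp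
  moreover have "cell_index n -` {cell_index n p} = cell n p" for p
    by (auto simp: cell_def)
  ultimately show "(\<lambda>p. measure \<nu> (cell n p) * 4 ^ n) \<in> borel_measurable borel"
    by simp
qed

lemma limit_nonneg: "0 \<le> f p"
  by (rule LIMSEQ_le_const[OF lim]) auto

lemma emeasure_le_if_limit_less:
  assumes "E \<in> sets borel" "0 < a" "\<And>p. p \<in> E \<Longrightarrow> f p < a"
  shows "emeasure \<nu> E \<le> ennreal a * emeasure lborel E"
proof (rule emeasure_le_if_cells_le)
  fix p assume "p \<in> E"
  then have "\<forall>\<^sub>F n in sequentially. measure \<nu> (cell n p) * 4 ^ n < a"
    using assms(3) by (intro order_tendstoD(2)[OF lim])
  then show "\<forall>\<^sub>F n in sequentially. emeasure \<nu> (cell n p) \<le> ennreal a * emeasure lborel (cell n p)"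
  proof eventually_elim
    case (elim n)
    have "emeasure \<nu> (cell n p) = ennreal (measure \<nu> (cell n p))" by (rule emeasure_eq_measure)
    also have "\<dots> \<le> ennreal (a * (1 / 4 ^ n))"
      using elim by (intro ennreal_leI) (simp add: field_simps)
    also have "\<dots> = ennreal a * emeasure lborel (cell n p)"
      using \<open>0 < a\<close> by (simp add: emeasure_lborel_cell ennreal_mult'[symmetric])
    finally show ?case .
  qed
qed (use assms lborel_outer_open in auto)

text \<open>This is the covering argument with the measures exchanged and constant
  \<open>1 / b\<close>; here outer regularity of \<nu> is what counts.\<close>

lemma emeasure_ge_if_limit_greater:
  assumes "E \<in> sets borel" "0 < b" "\<And>p. p \<in> E \<Longrightarrow> b < f p"
  shows "ennreal b * emeasure lborel E \<le> emeasure \<nu> E"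
proof -
  have "emeasure lborel E \<le> ennreal (1 / b) * emeasure \<nu> E"
  proof (rule emeasure_le_if_cells_le)
    fix p assume "p \<in> E"
    then have "\<forall>\<^sub>F n in sequentially. b < measure \<nu> (cell n p) * 4 ^ n"
      using assms(3) by (intro order_tendstoD(1)[OF lim])
    then show "\<forall>\<^sub>F n in sequentially. emeasure lborel (cell n p) \<le> ennreal (1 / b) * emeasure \<nu> (cell n p)"
    proof eventually_elim
      case (elim n)
      have "emeasure lborel (cell n p) \<le> ennreal (1 / b * measure \<nu> (cell n p))"
        unfolding emeasure_lborel_cell
        using elim \<open>0 < b\<close> by (intro ennreal_leI) (simp add: field_simps)
      also have "\<dots> = ennreal (1 / b) * emeasure \<nu> (cell n p)"
        using \<open>0 < b\<close> by (simp only: emeasure_eq_measure) (simp add: ennreal_mult' del: times_divide_eq_left)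
      finally show ?case .
    qed
  qed (use assms finite_measure_outer_open[OF finite_measure_axioms sets_eq assms(1)] in auto)
  then have "ennreal b * emeasure lborel E \<le> ennreal b * (ennreal (1 / b) * emeasure \<nu> E)"
    by (intro mult_left_mono) auto
  also have "\<dots> = emeasure \<nu> E"
    using \<open>0 < b\<close> by (simp add: mult.assoc[symmetric] ennreal_mult'[symmetric])
  finally show ?thesis .
qed

text \<open>Finiteness of the limit at every point is what excludes a singular part.\<close>

lemma absolutely_continuous_lborel: "absolutely_continuous lborel \<nu>"
  unfolding absolutely_continuous_def
proof
  fix E assume "E \<in> null_sets (lborel :: (real \<times> real) measure)"
  then have E: "E \<in> sets borel" "emeasure lborel E = 0" by auto
  \<comment> \<open>On a sublevel set of \<open>f\<close> the comparison bounds \<nu> by a constant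
    times zero. Using \<open>Suc k\<close> keeps the constant positive.\<close>
  have "E \<inter> {p. f p < real (Suc k)} \<in> null_sets \<nu>" for k
  proof -
    have B: "E \<inter> {p. f p < real (Suc k)} \<in> sets borel"
      using E(1) by measurable
    have "emeasure lborel (E \<inter> {p. f p < real (Suc k)}) \<le> emeasure lborel E"
      using E(1) by (intro emeasure_mono) auto
    then have "emeasure \<nu> (E \<inter> {p. f p < real (Suc k)}) \<le> 0"
      using emeasure_le_if_limit_less[OF B, of "real (Suc k)"] E(2) by simp
    then show ?thesis using B by (intro null_setsI) auto
  qed
  then have "(\<Union>k. E \<inter> {p. f p < real (Suc k)}) \<in> null_sets \<nu>" by (rule null_sets_UN)
  moreover have "(\<Union>k. E \<inter> {p. f p < real (Suc k)}) = E"
  proof -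
    have "\<exists>k. f p < real (Suc k)" for p
      using reals_Archimedean2[of "f p"] by (metis less_trans lessI of_nat_less_iff)
    then show ?thesis by blast
  qed
  ultimately show "E \<in> null_sets \<nu>" by simp
qed

text \<open>Let \<open>g\<close> be a Radon-Nikodym density of \<nu>. On a set where
  \<open>f < a < b < g\<close>, the comparison gives measure at most \<open>a\<close> times area
  while integrating \<open>g\<close> gives at least \<open>b\<close> times area, so the area is
  zero; the opposite order is symmetric. Rational \<open>a\<close> and \<open>b\<close> separate
  \<open>f\<close> and \<open>g\<close> wherever they differ.\<close>

lemma density_limit: "density lborel (\<lambda>p. ennreal (f p)) = \<nu>"
proof -
  obtain g where g [measurable]: "g \<in> borel_measurable borel" and \<nu>: "density lborel g = \<nu>"
    using sigma_finite_measure.Radon_Nikodym[OF sigma_finite_lborel absolutely_continuous_lborel] by auto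
  \<comment> \<open>Cancelling the area from the inequality needs it to be finite, hence the
    exhaustion by balls.\<close>
  have null: "E \<in> null_sets lborel"
    if E [measurable]: "E \<in> sets borel" and ab: "0 < a" "a < b"
      and le: "\<And>A. A \<in> sets borel \<Longrightarrow> A \<subseteq> E \<Longrightarrow> ennreal b * emeasure lborel A \<le> ennreal a * emeasure lborel A"
    for E :: "(real \<times> real) set" and a b :: real
  proof -
    have "E \<inter> ball 0 (real k) \<in> null_sets lborel" for k
    proof -
      let ?A = "E \<inter> ball 0 (real k)"
      have "emeasure lborel ?A \<le> emeasure lborel (ball 0 (real k) :: (real \<times> real) set)"
        by (intro emeasure_mono) auto
      also have "\<dots> < \<infinity>" by (rule emeasure_lborel_ball_finite)
      finally obtain x where x: "0 \<le> x" "emeasure lborel ?A = ennreal x"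
        by (cases "emeasure lborel ?A") auto
      then have "b * x \<le> a * x"
        using le[of ?A] ab by (simp add: ennreal_mult'[symmetric])
      then have "x = 0" using ab(2) x(1) by (metis mult_strict_right_mono not_le order_le_less)
      then show ?thesis using x by (intro null_setsI) auto
    qed
    then have "(\<Union>k. E \<inter> ball 0 (real k)) \<in> null_sets lborel" by (rule null_sets_UN)
    moreover have "(\<Union>k. E \<inter> ball 0 (real k)) = E"
      by (auto intro: reals_Archimedean2)
    ultimately show ?thesis by simp
  qed
  have emeasure_\<nu>: "emeasure \<nu> A = (\<integral>\<^sup>+p. g p * indicator A p \<partial>lborel)" if "A \<in> sets borel" for A
    using that unfolding \<nu>[symmetric] by (simp add: emeasure_density)
  have below: "AE p in lborel. \<not> (f p < a \<and> ennreal b < g p)" if ab: "0 < a" "a < b" for a b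
  proof (rule AE_I')
    show "{p. f p < a \<and> ennreal b < g p} \<in> null_sets lborel"
    proof (rule null[OF _ ab])
      fix A :: "(real \<times> real) set"
      assume A [measurable]: "A \<in> sets borel" and sub: "A \<subseteq> {p. f p < a \<and> ennreal b < g p}"
      have "ennreal b * emeasure lborel A = (\<integral>\<^sup>+p. ennreal b * indicator A p \<partial>lborel)"
        by (simp add: nn_integral_cmult_indicator)
      also have "\<dots> \<le> emeasure \<nu> A"
        unfolding emeasure_\<nu>[OF A] using sub
        by (intro nn_integral_mono) (auto simp: indicator_def intro: less_imp_le)
      also have "\<dots> \<le> ennreal a * emeasure lborel A"
        using sub ab by (intro emeasure_le_if_limit_less) auto
      finally show "ennreal b * emeasure lborel A \<le> ennreal a * emeasure lborel A" .
    qed measurable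
  qed auto
  have above: "AE p in lborel. \<not> (g p < ennreal a \<and> b < f p)" if ab: "0 < a" "a < b" for a b
  proof (rule AE_I')
    show "{p. g p < ennreal a \<and> b < f p} \<in> null_sets lborel"
    proof (rule null[OF _ ab])
      fix A :: "(real \<times> real) set"
      assume A [measurable]: "A \<in> sets borel" and sub: "A \<subseteq> {p. g p < ennreal a \<and> b < f p}"
      have "ennreal b * emeasure lborel A \<le> emeasure \<nu> A"
        using sub ab by (intro emeasure_ge_if_limit_greater) auto
      also have "\<dots> \<le> (\<integral>\<^sup>+p. ennreal a * indicator A p \<partial>lborel)"
        unfolding emeasure_\<nu>[OF A] using sub
        by (intro nn_integral_mono) (auto simp: indicator_def intro: less_imp_le)
      also have "\<dots> = ennreal a * emeasure lborel A"
        by (simp add: nn_integral_cmult_indicator)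
      finally show "ennreal b * emeasure lborel A \<le> ennreal a * emeasure lborel A" .
    qed measurable
  qed auto
  \<comment> \<open>Restricting to rational thresholds leaves countably many exceptional null
    sets.\<close>
  have "AE p in lborel. \<forall>(a::rat) (b::rat). 0 < a \<and> a < b \<longrightarrow>
      \<not> (f p < of_rat a \<and> ennreal (of_rat b) < g p) \<and> \<not> (g p < ennreal (of_rat a) \<and> of_rat b < f p)"
    unfolding AE_all_countable using below above by (simp add: of_rat_less)
  then have "AE p in lborel. ennreal (f p) = g p"
  proof eventually_elim
    case (elim p)
    show ?case
    proof (rule antisym; rule ccontr)
      assume "\<not> ennreal (f p) \<le> g p"
      then have less: "g p < ennreal (f p)" by simp
      then obtain y where y: "g p = ennreal y" "0 \<le> y" by (cases "g p") auto
      then have "y < f p" using less by (simp add: ennreal_less_iff)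
      then obtain a where a: "y < of_rat a" "of_rat a < f p" using of_rat_dense by blast
      then obtain b where b: "real_of_rat a < of_rat b" "of_rat b < f p" using of_rat_dense by blast
      have "0 < real_of_rat a" using a y by linarith
      then show False using elim[rule_format, of a b] a b y
        by (simp add: of_rat_less ennreal_less_iff)
    next
      assume "\<not> g p \<le> ennreal (f p)"
      then have "ennreal (f p) < g p" by simp
      \<comment> \<open>The value \<open>g p\<close> may be infinite, so a finite value strictly
        below it is interposed before choosing rationals.\<close>
      then obtain y where y: "ennreal (f p) < y" "y < g p" using dense by blast
      then obtain z where z: "y = ennreal z" "0 \<le> z" by (cases y) auto
      then have "f p < z" using y limit_nonneg[of p] by (simp add: ennreal_less_iff)
      then obtain a where a: "f p < of_rat a" "of_rat a < z" using of_rat_dense by blast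
      then obtain b where b: "real_of_rat a < of_rat b" "of_rat b < z" using of_rat_dense by blast
      have pos: "0 < real_of_rat a" using a limit_nonneg[of p] by linarith
      then have "ennreal (of_rat b) < ennreal z" using b by (intro ennreal_lessI) linarith+
      then have "ennreal (of_rat b) < g p" using y z by simp
      then show False using elim[rule_format, of a b] a b pos
        by (simp add: of_rat_less)
    qed
  qed
  then have "density lborel (\<lambda>p. ennreal (f p)) = density lborel g"
    by (intro density_cong) auto
  then show ?thesis using \<nu> by simp
qed

end

section \<open>Random intervals\<close>

lemma sigma_finite_uniform_interval_measure: "sigma_finite_measure uniform_interval_measure"
proof
  let ?A = "\<lambda>k::nat. endpoints -` ball 0 (real k)"
  have sets: "?A k \<in> sets interval_borel" for k
    using measurable_sets[OF endpoints_measurable, of "ball 0 (real k)"] by simp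
  have "emeasure uniform_interval_measure (?A k) \<noteq> \<infinity>" for k
  proof -
    have "emeasure lborel (endpoints ` ?A k) \<le> emeasure lborel (ball 0 (real k) :: (real \<times> real) set)"
      by (intro emeasure_mono) auto
    also have "\<dots> < \<infinity>" by (rule emeasure_lborel_ball_finite)
    finally show ?thesis by (simp add: emeasure_uniform_interval_measure[OF sets])
  qed
  moreover have "(\<Union>k. ?A k) = UNIV"
    by (auto intro: reals_Archimedean2)
  ultimately show "\<exists>A. countable A \<and> A \<subseteq> sets uniform_interval_measure \<and>
      \<Union> A = space uniform_interval_measure \<and> (\<forall>a\<in>A. emeasure uniform_interval_measure a \<noteq> \<infinity>)"
    using sets by (intro exI[of _ "range ?A"]) auto
qed

lemma measurable_endpoints_uniform [measurable]:
  "endpoints \<in> uniform_interval_measure \<rightarrow>\<^sub>M borel"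
  using endpoints_measurable by (simp cong: measurable_cong_sets)

lemma range_endpoints_borel [measurable]: "range endpoints \<in> sets borel"
  using sets_endpoints_image[of UNIV] sets.top[of interval_borel] by simp

text \<open>Pulling a planar set back to intervals and mapping it forward again cuts it down to the
  half-plane of valid end points, so the image measure is Lebesgue measure restricted there.\<close>

lemma distr_endpoints_uniform_interval_measure:
  "distr uniform_interval_measure borel endpoints = density lborel (indicator (range endpoints))"
proof (rule measure_eqI)
  fix A assume "A \<in> sets (distr uniform_interval_measure borel endpoints)"
  then have A [measurable]: "A \<in> sets borel" by simp
  have "endpoints ` (endpoints -` A) = range endpoints \<inter> A" by auto
  moreover have "endpoints -` A \<in> sets interval_borel"
    using measurable_sets[OF endpoints_measurable A] by simp
  ultimately show "emeasure (distr uniform_interval_measure borel endpoints) A =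
      emeasure (density lborel (indicator (range endpoints))) A"
    by (simp add: emeasure_distr[OF measurable_endpoints_uniform] emeasure_uniform_interval_measure emeasure_density
        flip: indicator_inter_arith)
qed simp

lemma nn_integral_uniform_interval_measure:
  assumes [measurable]: "g \<in> borel_measurable borel"
  shows "(\<integral>\<^sup>+x. g (endpoints x) \<partial>uniform_interval_measure) =
    (\<integral>\<^sup>+p. indicator (range endpoints) p * g p \<partial>lborel)"
proof -
  have "(\<integral>\<^sup>+x. g (endpoints x) \<partial>uniform_interval_measure) =
      (\<integral>\<^sup>+p. g p \<partial>distr uniform_interval_measure borel endpoints)"
    by (simp add: nn_integral_distr)
  then show ?thesis
    by (simp add: distr_endpoints_uniform_interval_measure nn_integral_density)
qed

text \<open>Injectivity of \<open>endpoints\<close> lets every measurable set of intervals be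
  evaluated through its planar image, which carries a density from the plane back to the interval
  space. Sigma-finiteness then identifies it with \<open>RN_deriv\<close> almost everywhere.\<close>

lemma is_interval_density_if_density_endpoints:
  assumes X: "random_interval M X"
    and f [measurable]: "f \<in> borel_measurable borel" and nonneg: "\<And>p. 0 \<le> f p"
    and density: "density lborel (\<lambda>p. ennreal (f p)) = distr M borel (\<lambda>\<omega>. endpoints (X \<omega>))"
  shows "is_interval_density M X f"
proof -
  let ?U = uniform_interval_measure
  have f_meas: "(\<lambda>x. f (endpoints x)) \<in> borel_measurable ?U" by measurable
  have law: "density ?U (\<lambda>x. ennreal (f (endpoints x))) = interval_law M X"
  proof (rule measure_eqI)
    fix E assume "E \<in> sets (density ?U (\<lambda>x. ennreal (f (endpoints x))))"
    then have E: "E \<in> sets interval_borel" by simp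
    have img [measurable]: "endpoints ` E \<in> sets borel" using E by (rule sets_endpoints_image)
    have ind: "indicator (endpoints ` E) (endpoints x) = (indicator E x :: ennreal)" for x
      using inj_endpoints by (auto simp: indicator_def inj_image_mem_iff)
    have "emeasure (density ?U (\<lambda>x. ennreal (f (endpoints x)))) E =
        (\<integral>\<^sup>+x. ennreal (f (endpoints x)) * indicator (endpoints ` E) (endpoints x) \<partial>?U)"
      using E f_meas by (simp add: emeasure_density ind)
    also have "\<dots> = (\<integral>\<^sup>+p. indicator (range endpoints) p * (ennreal (f p) * indicator (endpoints ` E) p) \<partial>lborel)"
      by (rule nn_integral_uniform_interval_measure) measurable
    also have "\<dots> = (\<integral>\<^sup>+p. ennreal (f p) * indicator (endpoints ` E) p \<partial>lborel)"
      by (intro nn_integral_cong) (auto simp: indicator_def)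
    also have "\<dots> = emeasure (distr M borel (\<lambda>\<omega>. endpoints (X \<omega>))) (endpoints ` E)"
      unfolding density[symmetric] by (simp add: emeasure_density)
    also have "\<dots> = emeasure M ((\<lambda>\<omega>. endpoints (X \<omega>)) -` (endpoints ` E) \<inter> space M)"
      using measurable_compose[OF X endpoints_measurable] by (simp add: emeasure_distr)
    also have "(\<lambda>\<omega>. endpoints (X \<omega>)) -` (endpoints ` E) = X -` E"
      using inj_endpoints by (auto dest: injD)
    also have "emeasure M (X -` E \<inter> space M) = emeasure (interval_law M X) E"
      using X E by (simp add: emeasure_distr)
    finally show "emeasure (density ?U (\<lambda>x. ennreal (f (endpoints x)))) E =
        emeasure (interval_law M X) E" .
  qed simp
  interpret U: sigma_finite_measure ?U by (rule sigma_finite_uniform_interval_measure)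
  have "absolutely_continuous ?U (interval_law M X)"
    unfolding law[symmetric] by (intro absolutely_continuousI_density) measurable
  moreover have "AE x in ?U. ennreal (f (endpoints x)) = RN_deriv ?U (interval_law M X) x"
    by (intro U.RN_deriv_unique law) measurable
  then have "AE x in ?U. 0 \<le> f (endpoints x) \<and>
      RN_deriv ?U (interval_law M X) x = ennreal (f (endpoints x))"
    by eventually_elim (simp add: nonneg)
  ultimately show ?thesis
    using f_meas unfolding is_interval_density_def by blast
qed

section \<open>From the containment function to probabilities of cells\<close>

text \<open>For \<open>u > v\<close> the event is empty because \<open>lower\<close> never exceeds
  \<open>upper\<close>, which agrees with the conventional value 0. One formula thus serves the
  whole plane, including squares that cross the diagonal.\<close>

lemma containment_cdf_eq:
  "containment_cdf M X (u, v) =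
    measure M {\<omega> \<in> space M. u \<le> lower (X \<omega>) \<and> upper (X \<omega>) \<le> v}"
proof (cases "u \<le> v")
  case True
  have "set_of (X \<omega>) \<subseteq> {u..v} \<longleftrightarrow> u \<le> lower (X \<omega>) \<and> upper (X \<omega>) \<le> v" for \<omega>
    using lower_le_upper[of "X \<omega>"] by (simp add: set_of_eq)
  then show ?thesis using True by (simp add: containment_cdf_def)
next
  case False
  have "\<not> (u \<le> lower (X \<omega>) \<and> upper (X \<omega>) \<le> v)" for \<omega>
    using False lower_le_upper[of "X \<omega>"] by linarith
  then have "{\<omega> \<in> space M. u \<le> lower (X \<omega>) \<and> upper (X \<omega>) \<le> v} = {}"
    by blast
  then show ?thesis
    using False by (simp only: containment_cdf_def case_prod_conv if_False measure_empty)
qed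

text \<open>The containment function decreases in \<open>u\<close> and increases in
  \<open>v\<close>; this opposite monotonicity produces the minus sign and the half-open sides of
  the rectangle.\<close>

lemma (in finite_measure) measure_endpoints_rectangle:
  assumes X: "random_interval M X" and h: "0 \<le> h"
  shows "measure (distr M borel (\<lambda>\<omega>. endpoints (X \<omega>))) ({s..<s + h} \<times> {t<..t + h}) =
    - (containment_cdf M X (s + h, t + h) - containment_cdf M X (s, t + h)
       - containment_cdf M X (s + h, t) + containment_cdf M X (s, t))"
proof -
  have XE: "(\<lambda>\<omega>. endpoints (X \<omega>)) \<in> M \<rightarrow>\<^sub>M borel"
    using measurable_compose[OF X endpoints_measurable] .
  have [measurable]: "(\<lambda>\<omega>. lower (X \<omega>)) \<in> borel_measurable M" "(\<lambda>\<omega>. upper (X \<omega>)) \<in> borel_measurable M"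
    using measurable_compose[OF XE, of fst borel] measurable_compose[OF XE, of snd borel]
    by (simp_all add: endpoints_def borel_prod[symmetric])
  define Q where "Q u v = {\<omega> \<in> space M. u \<le> lower (X \<omega>) \<and> upper (X \<omega>) \<le> v}" for u v
  have [measurable]: "Q u v \<in> sets M" for u v unfolding Q_def by measurable
  define R where "R v = {\<omega> \<in> space M. s \<le> lower (X \<omega>) \<and> lower (X \<omega>) < s + h \<and> upper (X \<omega>) \<le> v}" for v
  have [measurable]: "R v \<in> sets M" for v unfolding R_def by measurable
  have R: "measure M (R v) = measure M (Q s v) - measure M (Q (s + h) v)" for v
  proof -
    have "R v = Q s v - Q (s + h) v" by (auto simp: R_def Q_def)
    moreover have "Q (s + h) v \<subseteq> Q s v" using h by (auto simp: Q_def)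
    ultimately show ?thesis by (simp add: finite_measure_Diff)
  qed
  have "measure (distr M borel (\<lambda>\<omega>. endpoints (X \<omega>))) ({s..<s + h} \<times> {t<..t + h}) =
      measure M ((\<lambda>\<omega>. endpoints (X \<omega>)) -` ({s..<s + h} \<times> {t<..t + h}) \<inter> space M)"
  proof (rule measure_distr[OF XE])
    have "{s..<s + h} \<times> {t<..t + h} \<in> sets (borel \<Otimes>\<^sub>M borel)" by (intro pair_measureI) auto
    then show "{s..<s + h} \<times> {t<..t + h} \<in> sets borel" by (simp only: borel_prod)
  qed
  also have "(\<lambda>\<omega>. endpoints (X \<omega>)) -` ({s..<s + h} \<times> {t<..t + h}) \<inter> space M = R (t + h) - R t"
    by (auto simp: R_def endpoints_def)
  also have "measure M \<dots> = measure M (R (t + h)) - measure M (R t)"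
  proof (rule finite_measure_Diff)
    show "R t \<subseteq> R (t + h)" using h by (auto simp: R_def)
  qed measurable
  finally show ?thesis unfolding R by (simp add: containment_cdf_eq Q_def)
qed

lemma cell_ratio_tendsto_mixed_partial:
  assumes "finite_measure M" and X: "random_interval M X"
    and "twice_differentiable (containment_cdf M X)"
  shows "(\<lambda>n. measure (distr M borel (\<lambda>\<omega>. endpoints (X \<omega>))) (cell n p) * 4 ^ n)
    \<longlonglongrightarrow> - mixed_partial (containment_cdf M X) p"
proof -
  interpret finite_measure M by fact
  define F where "F = containment_cdf M X"
  obtain F' :: "real \<times> real \<Rightarrow> (real \<times> real) \<Rightarrow>\<^sub>L real"
    where F': "\<And>p. (F has_derivative blinfun_apply (F' p)) (at p)" "\<And>p. F' differentiable (at p)"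
    using assms(3) unfolding twice_differentiable_def F_def by blast
  \<comment> \<open>Evaluating the total derivative at \<open>(0, 1)\<close> gives the partial
    derivative in \<open>v\<close>. Evaluation is bounded linear, so \<open>D\<close> inherits
    differentiability from \<open>F'\<close>.\<close>
  define D where "D p = F' p (0, 1)" for p
  have F: "((\<lambda>t. F (s, t)) has_real_derivative D (s, t)) (at t)" for s t
  proof -
    have "((\<lambda>t. F (s, t)) has_derivative (\<lambda>x. F' (s, t) (0, x))) (at t)"
      by (rule has_derivative_compose[OF _ F'(1)]) (auto intro!: derivative_eq_intros)
    moreover have "F' (s, t) (0, x) = D (s, t) * x" for x
      using blinfun.scaleR_right[of "F' (s, t)" x "(0, 1)"] by (simp add: D_def)
    ultimately show ?thesis by (simp add: has_field_derivative_def)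
  qed
  obtain A where "(F' has_derivative A) (at p)" using F'(2) unfolding differentiable_def by blast
  then have D: "(D has_derivative (\<lambda>q. A q (0, 1))) (at p)"
    unfolding D_def by (auto intro!: derivative_eq_intros)
  define D' where "D' q = A q (0, 1)" for q
  interpret D': bounded_linear D' using D unfolding D'_def by (rule has_derivative_bounded_linear)
  obtain u v where p: "p = (u, v)" by fastforce
  have "((\<lambda>s. D (s, v)) has_derivative (\<lambda>x. D' (x, 0))) (at u)"
    using D unfolding p D'_def[symmetric]
    by (rule has_derivative_compose[rotated]) (auto intro!: derivative_eq_intros)
  moreover have "(\<lambda>x. D' (x, 0)) = (*) (D' (1, 0))"
  proof
    fix x show "D' (x, 0) = D' (1, 0) * x"
      using D'.scaleR[of x "(1, 0)"] by (simp only: scaleR_Pair real_scaleR_def) simp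
  qed
  ultimately have "((\<lambda>s. D (s, v)) has_real_derivative D' (1, 0)) (at u)"
    by (simp only: has_field_derivative_def)
  moreover have "deriv (\<lambda>t. F (s, t)) v = D (s, v)" for s
    using F by (rule DERIV_imp_deriv)
  \<comment> \<open>The inner \<open>deriv\<close> equals \<open>D (s, v)\<close> for every
    \<open>s\<close>, so the outer \<open>deriv\<close> really differentiates \<open>D\<close> along
    the first axis.\<close>
  ultimately have mixed: "mixed_partial F p = D' (1, 0)"
    unfolding mixed_partial_def p by (simp add: DERIV_imp_deriv)
  show ?thesis
    unfolding F_def[symmetric] mixed
  proof (rule LIMSEQ_I)
    fix r :: real assume "0 < r"
    obtain \<delta> where \<delta>: "\<delta> > 0" "\<And>h s t. 0 < h \<Longrightarrow> h < \<delta> \<Longrightarrow> fst p \<in> {s..s + h} \<Longrightarrow> snd p \<in> {t..t + h} \<Longrightarrow>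
      \<bar>(F (s + h, t + h) - F (s, t + h) - F (s + h, t) + F (s, t)) / h\<^sup>2 - D' (1, 0)\<bar> \<le> r / 2"
      \<comment> \<open>Half of \<open>r\<close> turns the non-strict bound into the strict one
        demanded by the limit.\<close>
      using second_difference_approx[OF F D[folded D'_def], of "r / 2"] \<open>0 < r\<close> by auto
    have "(\<lambda>n. (1 / 2) ^ n :: real) \<longlonglongrightarrow> 0" by real_asymp
    then obtain N where N: "\<And>n. n \<ge> N \<Longrightarrow> (1 / 2) ^ n < \<delta>"
      using order_tendstoD(2)[of _ 0 sequentially \<delta>] \<delta>(1) unfolding eventually_sequentially by blast
    have "norm (measure (distr M borel (\<lambda>\<omega>. endpoints (X \<omega>))) (cell n p) * 4 ^ n - - D' (1, 0)) < r"
      if "n \<ge> N" for n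
    proof -
      define h :: real where "h = 1 / 2 ^ n"
      define s where "s = real_of_int \<lfloor>2 ^ n * fst p\<rfloor> / 2 ^ n"
      \<comment> \<open>The floor yields the closed upper edge of the cell; subtracting
        \<open>h\<close> gives the open lower edge.\<close>
      define t where "t = - real_of_int \<lfloor>2 ^ n * (- snd p)\<rfloor> / 2 ^ n - h"
      have cell: "cell n p = {s..<s + h} \<times> {t<..t + h}"
        unfolding cell_eq s_def t_def h_def by simp
      have h: "0 < h" "h < \<delta>" using N[OF that] by (auto simp: h_def power_one_over)
      have h2: "h\<^sup>2 = 1 / 4 ^ n" unfolding h_def power2_eq_square
        using power_mult_distrib[of "2::real" 2 n] by simp
      define \<Delta> where "\<Delta> = F (s + h, t + h) - F (s, t + h) - F (s + h, t) + F (s, t)"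
      have "\<bar>\<Delta> / h\<^sup>2 - D' (1, 0)\<bar> \<le> r / 2"
        using self_in_cell[of p n] h unfolding cell \<Delta>_def by (intro \<delta>(2)) auto
      moreover have "measure (distr M borel (\<lambda>\<omega>. endpoints (X \<omega>))) (cell n p) = - \<Delta>"
        using h unfolding cell \<Delta>_def F_def by (intro measure_endpoints_rectangle[OF X]) simp
      then have "norm (measure (distr M borel (\<lambda>\<omega>. endpoints (X \<omega>))) (cell n p) * 4 ^ n - - D' (1, 0))
          = \<bar>\<Delta> / h\<^sup>2 - D' (1, 0)\<bar>"
        by (simp add: h2)
      ultimately show ?thesis using \<open>0 < r\<close> by simp
    qed
    then show "\<exists>no. \<forall>n\<ge>no. norm (measure (distr M borel (\<lambda>\<omega>. endpoints (X \<omega>))) (cell n p) * 4 ^ n - - D' (1, 0)) < r"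
      by blast
  qed
qed

theorem theorem2:
  fixes M :: "'w measure" and X :: "'w \<Rightarrow> real interval"
  assumes "prob_space M"
    and "random_interval M X"
    and "twice_differentiable (containment_cdf M X)"
  shows "is_interval_density M X (\<lambda>p. - mixed_partial (containment_cdf M X) p)"
proof -
  interpret prob_space M by fact
  let ?\<nu> = "distr M borel (\<lambda>\<omega>. endpoints (X \<omega>))"
  have "prob_space ?\<nu>"
    using measurable_compose[OF assms(2) endpoints_measurable] by (rule prob_space_distr)
  then interpret \<nu>: prob_space ?\<nu> .
  \<comment> \<open>Differentiability on the whole plane supplies the limit at every point,
    including those with \<open>u > v\<close>.\<close>
  interpret cell_differentiable ?\<nu> "\<lambda>p. - mixed_partial (containment_cdf M X) p"
    using cell_ratio_tendsto_mixed_partial[OF finite_measure_axioms assms(2,3)]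
    by unfold_locales auto
  show ?thesis
    using assms(2) borel_measurable_limit limit_nonneg density_limit
    by (rule is_interval_density_if_density_endpoints)
qed

end
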